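(* Let $m,n$ be integers with $0\le m\le n$, and let $0\le i\le n-m$, $0\le j\le n-m$ be integers. Then $$\sum_{l=i}^{n-m}(-1)^{l-i}\binom{n-m}{l}\frac{(m+1/2)_l}{(m+1)_l}\binom{l}{i}=4^m\binom{n}{m}^{-1}\binom{2m}{m}^{-1}\binom{m+i}{m}a_{n,m+i},$$ and $$\sum_{l=j}^{n-m}\binom{m+l}{m}\binom{l}{j}a_{n,m+l}=4^{-m}\binom{n}{m}\binom{2m}{m}\frac{(m+1/2)_j}{(m+1)_j}\binom{n-m}{j}.$$
   Context: Notation: $(y)_0:=1$, $(y)_k:=y(y+1)\cdots(y+k-1)$ for $k\ge1$; $a_{n,j}:=4^{-n}\binom{2j}{j}\binom{2n-2j}{n-j}$ for $0\le j\le n$. *)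

theory Defs
  imports Complex_Main
begin

text \<open>
  The rising factorial \<open>(y)\<^sub>k = y (y + 1) \<dots> (y + k - 1)\<close> is the library's \<^const>\<open>pochhammer\<close>.

  The numbers \<open>a\<^sub>n\<^sub>,\<^sub>j\<close> are meant for \<open>j \<le> n\<close> only, where the truncated natural-number
  subtraction \<open>n - j\<close> is the ordinary one.
\<close>

definition a :: "nat \<Rightarrow> nat \<Rightarrow> real" where
  "a n j = real ((2 * j) choose j) * real ((2 * n - 2 * j) choose (n - j)) / 4 ^ n"

end

theory Submission
  imports Defs "HOL-Computational_Algebra.Formal_Power_Series"
begin

text \<open>
  Because \<open>(2k choose k) = 4\<^sup>k (1/2)\<^sub>k / k!\<close>, the numbers \<open>a\<^sub>n\<^sub>,\<^sub>j\<close> are products of rising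
  factorials at \<open>1/2\<close> divided by factorials (lemma \<open>a_eq_pochhammer\<close>), and both sums are
  hypergeometric. The substitutions \<open>l = i + k\<close> and \<open>l = j + k\<close>, the rule
  \<open>(y)\<^sub>i\<^sub>+\<^sub>k = (y)\<^sub>i (y + i)\<^sub>k\<close> and cancellation of factorials take out of each sum everything
  that does not depend on \<open>k\<close>. What remains is a form of the Chu--Vandermonde identity: with \<open>M\<close>
  the largest value of \<open>k\<close>, the first sum becomes
  \<open>\<Sum>\<^sub>k (-1)\<^sup>k (M choose k) (b)\<^sub>k / (c)\<^sub>k = (c - b)\<^sub>M / (c)\<^sub>M\<close> with \<open>b = m + i + 1/2\<close> and
  \<open>c = m + i + 1\<close>, and the second one
  \<open>\<Sum>\<^sub>k (M choose k) (b)\<^sub>k (1/2)\<^sub>M\<^sub>-\<^sub>k = (b + 1/2)\<^sub>M\<close> with \<open>b = m + j + 1/2\<close>. The special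
  parameter \<open>1/2\<close> is what makes both values explicit: \<open>c - b = 1/2\<close> in the first case, and
  \<open>b + 1/2\<close> is a positive integer in the second, so that its rising factorial is a quotient of
  factorials.
\<close>

lemma central_binomial_eq_pochhammer:
  "real ((2 * k) choose k) = 4 ^ k * pochhammer (1 / 2) k / fact k"
proof -
  have "real ((2 * k) choose k) = fact (2 * k) / (fact k * fact k)"
    by (simp add: binomial_fact mult_2)
  also have "(fact (2 * k) :: real) = 4 ^ k * pochhammer (1 / 2) k * fact k"
    by (simp add: fact_double power_mult)
  finally show ?thesis
    by simp
qed

lemma a_eq_pochhammer:
  "a (j + k) j = pochhammer (1 / 2) j * pochhammer (1 / 2) k / (fact j * fact k)"
proof -
  have "2 * (j + k) - 2 * j = 2 * k"
    by simp
  then have "a (j + k) j = real ((2 * j) choose j) * real ((2 * k) choose k) / 4 ^ (j + k)"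
    by (simp add: a_def)
  then show ?thesis
    by (simp add: central_binomial_eq_pochhammer power_add)
qed

lemma pochhammer_Suc_of_nat: "pochhammer (real p + 1) k = fact (p + k) / fact p"
  using pochhammer_product'[of "1 :: real" p k]
  by (simp add: pochhammer_fact[symmetric] add.commute field_simps)

lemma pochhammer_half_add:
  "pochhammer (1 / 2 :: real) (p + k) = pochhammer (1 / 2) p * pochhammer (real p + 1 / 2) k"
  using pochhammer_product'[of "1 / 2 :: real" p k] by (simp add: add.commute)

lemma binomial_add: "real ((p + q) choose p) = fact (p + q) / (fact p * fact q)"
  by (simp add: binomial_fact)

text \<open>
  The Chu--Vandermonde identity with the terminating numerator parameter written as a binomial
  coefficient, using \<open>(-M)\<^sub>k = (-1)\<^sup>k (M choose k) k!\<close>.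
\<close>

lemma alternating_binomial_pochhammer_sum:
  fixes b c :: real
  assumes "c > 0"
  shows "(\<Sum>k\<le>M. (- 1) ^ k * real (M choose k) * (pochhammer b k / pochhammer c k))
         = pochhammer (c - b) M / pochhammer c M"
proof -
  have "(- 1) ^ k * real (M choose k) = pochhammer (- real M) k / fact k" for k
    using gbinomial_pochhammer[of "real M" k]
    by (simp add: binomial_gbinomial mult.assoc[symmetric] flip: power_mult_distrib)
  then have "(\<Sum>k\<le>M. (- 1) ^ k * real (M choose k) * (pochhammer b k / pochhammer c k))
      = (\<Sum>k = 0..M. pochhammer b k * pochhammer (- real M) k
        / (of_nat (fact k) * pochhammer c k))"
    by (simp add: atMost_atLeast0 mult.commute)
  also have "\<dots> = pochhammer (c - b) M / pochhammer c M"
    using assms by (intro Vandermonde_pochhammer ballI) auto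
  finally show ?thesis .
qed

lemma sum_shift_to_zero:
  fixes f :: "nat \<Rightarrow> real"
  shows "(\<Sum>l = i..i + M. f l) = (\<Sum>k\<le>M. f (i + k))"
  by (rule sum.reindex_bij_witness[of _ "\<lambda>k. i + k" "\<lambda>l. l - i"]) auto

text \<open>
  Here and below the summation length \<open>M\<close> replaces \<open>n = m + i + M\<close>, so that no truncated
  subtraction is left in the factorials that have to cancel. The product of
  binomial coefficients splits into a constant and a coefficient of row \<open>M\<close> because
  \<open>(N choose l) (l choose i) = (N choose i) (N - i choose l - i)\<close>.
\<close>

lemma alternating_sum_eq:
  "(\<Sum>l = i..i + M. (- 1) ^ (l - i) * real ((i + M) choose l)
      * (pochhammer (real m + 1 / 2) l / pochhammer (real m + 1) l) * real (l choose i))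
   = 4 ^ m * inverse (real ((m + i + M) choose m)) * inverse (real ((2 * m) choose m))
      * real ((m + i) choose m) * a (m + i + M) (m + i)"
proof -
  define b where "b = real m + real i + 1 / 2"
  define c where "c = real m + real i + 1"
  define C where "C = real ((i + M) choose i)
    * (pochhammer (real m + 1 / 2) i / pochhammer (real m + 1) i)"
  have summand: "(- 1) ^ (i + k - i) * real ((i + M) choose (i + k))
      * (pochhammer (real m + 1 / 2) (i + k) / pochhammer (real m + 1) (i + k))
      * real ((i + k) choose i)
    = C * ((- 1) ^ k * real (M choose k) * (pochhammer b k / pochhammer c k))"
    if "k \<le> M" for k
  proof -
    have "((i + M) choose (i + k)) * ((i + k) choose i) = ((i + M) choose i) * (M choose k)"
      using choose_mult[of i "i + k" "i + M"] that by simp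
    then have "real ((i + M) choose (i + k)) * real ((i + k) choose i)
        = real ((i + M) choose i) * real (M choose k)"
      by (metis of_nat_mult)
    moreover have "pochhammer (real m + 1 / 2) (i + k) = pochhammer (real m + 1 / 2) i * pochhammer b k"
      "pochhammer (real m + 1) (i + k) = pochhammer (real m + 1) i * pochhammer c k"
      by (simp_all add: pochhammer_product' b_def c_def algebra_simps)
    ultimately show ?thesis
      by (simp add: C_def)
  qed
  have "(\<Sum>l = i..i + M. (- 1) ^ (l - i) * real ((i + M) choose l)
      * (pochhammer (real m + 1 / 2) l / pochhammer (real m + 1) l) * real (l choose i))
    = C * (\<Sum>k\<le>M. (- 1) ^ k * real (M choose k) * (pochhammer b k / pochhammer c k))"
    unfolding sum_shift_to_zero sum_distrib_left by (intro sum.cong refl summand) simp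
  also have "\<dots> = C * (pochhammer (c - b) M / pochhammer c M)"
    by (subst alternating_binomial_pochhammer_sum) (simp_all add: c_def)
  also have "c - b = 1 / 2"
    by (simp add: b_def c_def)
  also have "pochhammer c M = fact (m + i + M) / fact (m + i)"
    using pochhammer_Suc_of_nat[of "m + i" M] by (simp add: c_def)
  also have "C * (pochhammer (1 / 2) M / (fact (m + i + M) / fact (m + i)))
    = 4 ^ m * inverse (real ((m + i + M) choose m)) * inverse (real ((2 * m) choose m))
      * real ((m + i) choose m) * a (m + i + M) (m + i)"
  proof -
    have "pochhammer (1 / 2 :: real) m \<noteq> 0"
      using pochhammer_pos[of "1 / 2 :: real" m] by simp
    moreover have "a (m + i + M) (m + i) = pochhammer (1 / 2) m * pochhammer (real m + 1 / 2) i
        * pochhammer (1 / 2) M / (fact (m + i) * fact M)"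
      by (simp add: a_eq_pochhammer pochhammer_half_add)
    ultimately show ?thesis
      using binomial_add[of m "i + M"]
      by (simp add: C_def central_binomial_eq_pochhammer binomial_add
          pochhammer_Suc_of_nat add.assoc)
        (simp only: mult_ac)
  qed
  finally show ?thesis .
qed

text \<open>
  The product \<open>(m + l choose m) (l choose j)\<close> equals \<open>(m + l)! / (m! j! (l - j)!)\<close>, whose
  numerator cancels against the denominator of \<open>a\<^sub>n\<^sub>,\<^sub>m\<^sub>+\<^sub>l\<close>. The remaining
  \<open>1 / ((l - j)! (n - m - l)!)\<close> is, up to a constant factor, the binomial coefficient of Vandermonde's convolution.
\<close>

lemma weighted_a_sum_eq:
  "(\<Sum>l = j..j + M. real ((m + l) choose m) * real (l choose j) * a (m + j + M) (m + l))
   = inverse (4 ^ m) * real ((m + j + M) choose m) * real ((2 * m) choose m)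
      * (pochhammer (real m + 1 / 2) j / pochhammer (real m + 1) j) * real ((j + M) choose j)"
proof -
  define b where "b = real m + real j + 1 / 2"
  define C where "C = pochhammer (1 / 2 :: real) (m + j) / (fact m * fact j * fact M)"
  have summand: "real ((m + (j + k)) choose m) * real ((j + k) choose j) * a (m + j + M) (m + (j + k))
    = C * (real (M choose k) * pochhammer b k * pochhammer (1 / 2) (M - k))"
    if "k \<le> M" for k
  proof -
    obtain r where r: "M = k + r"
      using le_Suc_ex[OF \<open>k \<le> M\<close>] by blast
    have "pochhammer (1 / 2 :: real) (m + (j + k)) = pochhammer (1 / 2) (m + j) * pochhammer b k"
      using pochhammer_half_add[of "m + j" k] by (simp add: b_def add.assoc)
    moreover have "a (m + j + M) (m + (j + k))
      = pochhammer (1 / 2) (m + (j + k)) * pochhammer (1 / 2) r / (fact (m + (j + k)) * fact r)"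
      using a_eq_pochhammer[of "m + (j + k)" r] by (simp add: r add.assoc)
    ultimately show ?thesis
      by (simp add: C_def binomial_add r)
  qed
  have "(\<Sum>l = j..j + M. real ((m + l) choose m) * real (l choose j) * a (m + j + M) (m + l))
    = C * (\<Sum>k\<le>M. real (M choose k) * pochhammer b k * pochhammer (1 / 2) (M - k))"
    unfolding sum_shift_to_zero sum_distrib_left by (intro sum.cong refl summand) simp
  also have "\<dots> = C * pochhammer (b + 1 / 2) M"
    by (simp add: pochhammer_binomial_sum)
  also have "pochhammer (b + 1 / 2) M = fact (m + j + M) / fact (m + j)"
    using pochhammer_Suc_of_nat[of "m + j" M] by (simp add: b_def add.assoc)
  also have "C * (fact (m + j + M) / fact (m + j))
    = inverse (4 ^ m) * real ((m + j + M) choose m) * real ((2 * m) choose m)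
      * (pochhammer (real m + 1 / 2) j / pochhammer (real m + 1) j) * real ((j + M) choose j)"
    using binomial_add[of m "j + M"]
    by (simp add: C_def central_binomial_eq_pochhammer binomial_add
        pochhammer_Suc_of_nat pochhammer_half_add add.assoc divide_simps)
  finally show ?thesis .
qed

theorem corollary2p2:
  fixes m n i j :: nat
  assumes "m \<le> n" and "i \<le> n - m" and "j \<le> n - m"
  shows "(\<Sum>l = i..n - m. (- 1) ^ (l - i) * real ((n - m) choose l)
            * (pochhammer (real m + 1 / 2) l / pochhammer (real m + 1) l) * real (l choose i))
          = 4 ^ m * inverse (real (n choose m)) * inverse (real ((2 * m) choose m))
            * real ((m + i) choose m) * a n (m + i)
       \<and> (\<Sum>l = j..n - m. real ((m + l) choose m) * real (l choose j) * a n (m + l))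
          = inverse (4 ^ m) * real (n choose m) * real ((2 * m) choose m)
            * (pochhammer (real m + 1 / 2) j / pochhammer (real m + 1) j) * real ((n - m) choose j)"
proof -
  have "i + (n - m - i) = n - m" "m + i + (n - m - i) = n"
    "j + (n - m - j) = n - m" "m + j + (n - m - j) = n"
    using assms by auto
  then show ?thesis
    using alternating_sum_eq[of i "n - m - i" m] weighted_a_sum_eq[of m j "n - m - j"]
    by simp
qed

end
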